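(* Let $\Sigma$ be a monoidal signature. Two morphism expressions over $\Sigma$ with the same domain and the same codomain denote the same morphism of the free strict monoidal category on $\Sigma$ if and only if their associated labelled diagrams are related by a finite sequence of right and left exchanges.
   Context: A monoidal signature $\Sigma$ consists of a set of generating objects and a set of generators, each generator $f$ having a domain and a codomain which are finite words over the generating objects. Morphism expressions are built from generators, identities $1_A$ ($A$ a word), composites $f\circ g$ (defined when the codomain of $g$ equals the domain of $f$; $g$ is applied first) and tensor products $f\otimes g$; each denotes a morphism of the free strict monoidal category on $\Sigma$. A labelled diagram is a tuple $(S,N,H,I,O,L)$ with $S,N\in\mathbb N$, functions $H,I,O:\{0,\dots,N-1\}\to\mathbb N$ and a labelling $L$ of $\{0,\dots,N-1\}$ by generators. The labelled diagram of an expression $\phi$ with domain of length $a$ is $(a,N,H,I,O,L)$ where the list of triples $(H(n),I(n),O(n))$ with labels $L(n)$, $n=0,\dots,N-1$, is produced by the following recursive procedure $\mathrm{conv}(\phi,\mathrm{offset})$ (started with offset $0$ and an empty list), which appends entries to the list and returns the pair (number of inputs, number of outputs) of $\phi$: for $\phi=f\circ g$, run $\mathrm{conv}(g,\mathrm{offset})$ returning $(a,b)$, then $\mathrm{conv}(f,\mathrm{offset})$ returning $(b,c)$, and return $(a,c)$; for $\phi=f\otimes g$, run $\mathrm{conv}(f,\mathrm{offset})$ returning $(a,b)$, then $\mathrm{conv}(g,\mathrm{offset}+b)$ returning $(c,d)$, and return $(a+c,b+d)$; for a generator $f$ with $a$ inputs and $b$ outputs (lengths of its domain and codomain), append the entry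 $(\mathrm{offset},a,b)$ labelled $f$ and return $(a,b)$; for $1_A$ with $A$ of length $l$, append nothing and return $(l,l)$. Put $\Delta(n)=O(n)-I(n)$. For $0\le n\le N-2$, a labelled diagram admits a right exchange at height $n$ if $H(n+1)\ge H(n)+O(n)$; the result is identical except that $H(n),I(n),O(n),L(n)$ become $H(n+1)-\Delta(n),I(n+1),O(n+1),L(n+1)$ and $H(n+1),I(n+1),O(n+1),L(n+1)$ become $H(n),I(n),O(n),L(n)$. It admits a left exchange at height $n$ if $H(n)\ge H(n+1)+I(n+1)$; the result is identical except that $H(n),I(n),O(n),L(n)$ become $H(n+1),I(n+1),O(n+1),L(n+1)$ and $H(n+1),I(n+1),O(n+1),L(n+1)$ become $H(n)+\Delta(n+1),I(n),O(n),L(n)$. *)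

theory Defs
  imports Main
begin

section \<open>Monoidal signatures and morphism expressions\<close>

record ('o, 'g) signature =
  sig_objs :: "'o set"
  sig_gens :: "'g set"
  gen_dom :: "'g \<Rightarrow> 'o list"
  gen_cod :: "'g \<Rightarrow> 'o list"

definition monoidal_signature :: "('o, 'g) signature \<Rightarrow> bool" where
  "monoidal_signature \<Sigma> \<longleftrightarrow>
     (\<forall>g \<in> sig_gens \<Sigma>. gen_dom \<Sigma> g \<in> lists (sig_objs \<Sigma>) \<and> gen_cod \<Sigma> g \<in> lists (sig_objs \<Sigma>))"

text \<open>\<open>Comp f g\<close> is \<open>f \<circ> g\<close>: \<open>g\<close> is applied first.\<close>

datatype ('o, 'g) expr =
    Gen 'g
  | Idt "'o list"
  | Comp "('o, 'g) expr" "('o, 'g) expr"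
  | Tens "('o, 'g) expr" "('o, 'g) expr"

primrec expr_dom :: "('o, 'g) signature \<Rightarrow> ('o, 'g) expr \<Rightarrow> 'o list" where
  "expr_dom \<Sigma> (Gen g) = gen_dom \<Sigma> g"
| "expr_dom \<Sigma> (Idt A) = A"
| "expr_dom \<Sigma> (Comp f g) = expr_dom \<Sigma> g"
| "expr_dom \<Sigma> (Tens f g) = expr_dom \<Sigma> f @ expr_dom \<Sigma> g"

primrec expr_cod :: "('o, 'g) signature \<Rightarrow> ('o, 'g) expr \<Rightarrow> 'o list" where
  "expr_cod \<Sigma> (Gen g) = gen_cod \<Sigma> g"
| "expr_cod \<Sigma> (Idt A) = A"
| "expr_cod \<Sigma> (Comp f g) = expr_cod \<Sigma> f"
| "expr_cod \<Sigma> (Tens f g) = expr_cod \<Sigma> f @ expr_cod \<Sigma> g"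

text \<open>The datatype also contains ill-typed terms; only the following ones are morphism
  expressions over \<open>\<Sigma>\<close>.\<close>

primrec morphism_expr :: "('o, 'g) signature \<Rightarrow> ('o, 'g) expr \<Rightarrow> bool" where
  "morphism_expr \<Sigma> (Gen g) \<longleftrightarrow> g \<in> sig_gens \<Sigma>"
| "morphism_expr \<Sigma> (Idt A) \<longleftrightarrow> A \<in> lists (sig_objs \<Sigma>)"
| "morphism_expr \<Sigma> (Comp f g) \<longleftrightarrow>
     morphism_expr \<Sigma> f \<and> morphism_expr \<Sigma> g \<and> expr_cod \<Sigma> g = expr_dom \<Sigma> f"
| "morphism_expr \<Sigma> (Tens f g) \<longleftrightarrow> morphism_expr \<Sigma> f \<and> morphism_expr \<Sigma> g"


section \<open>Strict monoidal categories\<close>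

record ('b, 'm) smcat =
  ob :: "'b set"
  ar :: "'m set"
  src :: "'m \<Rightarrow> 'b"
  tgt :: "'m \<Rightarrow> 'b"
  idn :: "'b \<Rightarrow> 'm"
  cmp :: "'m \<Rightarrow> 'm \<Rightarrow> 'm"
  unt :: "'b"
  tno :: "'b \<Rightarrow> 'b \<Rightarrow> 'b"
  tna :: "'m \<Rightarrow> 'm \<Rightarrow> 'm"

locale strict_monoidal_category =
  fixes C :: "('b, 'm) smcat"
  assumes src_ob: "f \<in> ar C \<Longrightarrow> src C f \<in> ob C"
    and tgt_ob: "f \<in> ar C \<Longrightarrow> tgt C f \<in> ob C"
    and idn_ar: "A \<in> ob C \<Longrightarrow> idn C A \<in> ar C"
    and src_idn: "A \<in> ob C \<Longrightarrow> src C (idn C A) = A"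
    and tgt_idn: "A \<in> ob C \<Longrightarrow> tgt C (idn C A) = A"
    and cmp_ar: "\<lbrakk>f \<in> ar C; g \<in> ar C; tgt C g = src C f\<rbrakk> \<Longrightarrow> cmp C f g \<in> ar C"
    and src_cmp: "\<lbrakk>f \<in> ar C; g \<in> ar C; tgt C g = src C f\<rbrakk> \<Longrightarrow> src C (cmp C f g) = src C g"
    and tgt_cmp: "\<lbrakk>f \<in> ar C; g \<in> ar C; tgt C g = src C f\<rbrakk> \<Longrightarrow> tgt C (cmp C f g) = tgt C f"
    and cmp_idn_left: "f \<in> ar C \<Longrightarrow> cmp C (idn C (tgt C f)) f = f"
    and cmp_idn_right: "f \<in> ar C \<Longrightarrow> cmp C f (idn C (src C f)) = f"
    and cmp_assoc:
      "\<lbrakk>f \<in> ar C; g \<in> ar C; h \<in> ar C; tgt C h = src C g; tgt C g = src C f\<rbrakk>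
       \<Longrightarrow> cmp C (cmp C f g) h = cmp C f (cmp C g h)"
    and unt_ob: "unt C \<in> ob C"
    and tno_ob: "\<lbrakk>A \<in> ob C; B \<in> ob C\<rbrakk> \<Longrightarrow> tno C A B \<in> ob C"
    and tno_unt_left: "A \<in> ob C \<Longrightarrow> tno C (unt C) A = A"
    and tno_unt_right: "A \<in> ob C \<Longrightarrow> tno C A (unt C) = A"
    and tno_assoc:
      "\<lbrakk>A \<in> ob C; B \<in> ob C; D \<in> ob C\<rbrakk> \<Longrightarrow> tno C (tno C A B) D = tno C A (tno C B D)"
    and tna_ar: "\<lbrakk>f \<in> ar C; g \<in> ar C\<rbrakk> \<Longrightarrow> tna C f g \<in> ar C"
    and src_tna: "\<lbrakk>f \<in> ar C; g \<in> ar C\<rbrakk> \<Longrightarrow> src C (tna C f g) = tno C (src C f) (src C g)"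
    and tgt_tna: "\<lbrakk>f \<in> ar C; g \<in> ar C\<rbrakk> \<Longrightarrow> tgt C (tna C f g) = tno C (tgt C f) (tgt C g)"
    and tna_idn:
      "\<lbrakk>A \<in> ob C; B \<in> ob C\<rbrakk> \<Longrightarrow> tna C (idn C A) (idn C B) = idn C (tno C A B)"
    and tna_cmp:
      "\<lbrakk>f \<in> ar C; g \<in> ar C; h \<in> ar C; k \<in> ar C; tgt C g = src C f; tgt C k = src C h\<rbrakk>
       \<Longrightarrow> tna C (cmp C f g) (cmp C h k) = cmp C (tna C f h) (tna C g k)"
    and tna_unt_left: "f \<in> ar C \<Longrightarrow> tna C (idn C (unt C)) f = f"
    and tna_unt_right: "f \<in> ar C \<Longrightarrow> tna C f (idn C (unt C)) = f"
    and tna_assoc: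
      "\<lbrakk>f \<in> ar C; g \<in> ar C; h \<in> ar C\<rbrakk> \<Longrightarrow> tna C (tna C f g) h = tna C f (tna C g h)"

definition strict_monoidal_functor ::
  "('b, 'm) smcat \<Rightarrow> ('c, 'n) smcat \<Rightarrow> ('b \<Rightarrow> 'c) \<Rightarrow> ('m \<Rightarrow> 'n) \<Rightarrow> bool" where
  "strict_monoidal_functor C D Fo Fa \<longleftrightarrow>
     (\<forall>A \<in> ob C. Fo A \<in> ob D \<and> Fa (idn C A) = idn D (Fo A)) \<and>
     (\<forall>f \<in> ar C. Fa f \<in> ar D \<and> src D (Fa f) = Fo (src C f) \<and> tgt D (Fa f) = Fo (tgt C f)) \<and>
     (\<forall>f \<in> ar C. \<forall>g \<in> ar C. tgt C g = src C f \<longrightarrow> Fa (cmp C f g) = cmp D (Fa f) (Fa g)) \<and>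
     Fo (unt C) = unt D \<and>
     (\<forall>A \<in> ob C. \<forall>B \<in> ob C. Fo (tno C A B) = tno D (Fo A) (Fo B)) \<and>
     (\<forall>f \<in> ar C. \<forall>g \<in> ar C. Fa (tna C f g) = tna D (Fa f) (Fa g))"

text \<open>The value of words and expressions in a strict monoidal category, given values \<open>vo\<close> of the
  generating objects and \<open>vg\<close> of the generators.\<close>

primrec eval_word :: "('b, 'm) smcat \<Rightarrow> ('o \<Rightarrow> 'b) \<Rightarrow> 'o list \<Rightarrow> 'b" where
  "eval_word C vo [] = unt C"
| "eval_word C vo (x # A) = tno C (vo x) (eval_word C vo A)"

definition valuation ::
  "('o, 'g) signature \<Rightarrow> ('b, 'm) smcat \<Rightarrow> ('o \<Rightarrow> 'b) \<Rightarrow> ('g \<Rightarrow> 'm) \<Rightarrow> bool" where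
  "valuation \<Sigma> C vo vg \<longleftrightarrow>
     (\<forall>x \<in> sig_objs \<Sigma>. vo x \<in> ob C) \<and>
     (\<forall>g \<in> sig_gens \<Sigma>. vg g \<in> ar C \<and>
        src C (vg g) = eval_word C vo (gen_dom \<Sigma> g) \<and>
        tgt C (vg g) = eval_word C vo (gen_cod \<Sigma> g))"

primrec eval_expr :: "('b, 'm) smcat \<Rightarrow> ('o \<Rightarrow> 'b) \<Rightarrow> ('g \<Rightarrow> 'm) \<Rightarrow> ('o, 'g) expr \<Rightarrow> 'm" where
  "eval_expr C vo vg (Gen g) = vg g"
| "eval_expr C vo vg (Idt A) = idn C (eval_word C vo A)"
| "eval_expr C vo vg (Comp f g) = cmp C (eval_expr C vo vg f) (eval_expr C vo vg g)"
| "eval_expr C vo vg (Tens f g) = tna C (eval_expr C vo vg f) (eval_expr C vo vg g)"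


section \<open>The free strict monoidal category on a signature\<close>

text \<open>The congruence on morphism expressions generated by the axioms of strict monoidal
  categories. The premises ensure that both sides are morphism expressions with the same domain
  and codomain.\<close>

inductive expr_eq :: "('o, 'g) signature \<Rightarrow> ('o, 'g) expr \<Rightarrow> ('o, 'g) expr \<Rightarrow> bool"
  for \<Sigma> :: "('o, 'g) signature" where
  refl: "morphism_expr \<Sigma> f \<Longrightarrow> expr_eq \<Sigma> f f"
| sym: "expr_eq \<Sigma> f g \<Longrightarrow> expr_eq \<Sigma> g f"
| trans: "\<lbrakk>expr_eq \<Sigma> f g; expr_eq \<Sigma> g h\<rbrakk> \<Longrightarrow> expr_eq \<Sigma> f h"
| comp_cong: "\<lbrakk>expr_eq \<Sigma> f f'; expr_eq \<Sigma> g g'; expr_cod \<Sigma> g = expr_dom \<Sigma> f\<rbrakk>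
    \<Longrightarrow> expr_eq \<Sigma> (Comp f g) (Comp f' g')"
| tens_cong: "\<lbrakk>expr_eq \<Sigma> f f'; expr_eq \<Sigma> g g'\<rbrakk> \<Longrightarrow> expr_eq \<Sigma> (Tens f g) (Tens f' g')"
| comp_id_left: "morphism_expr \<Sigma> f \<Longrightarrow> expr_eq \<Sigma> (Comp (Idt (expr_cod \<Sigma> f)) f) f"
| comp_id_right: "morphism_expr \<Sigma> f \<Longrightarrow> expr_eq \<Sigma> (Comp f (Idt (expr_dom \<Sigma> f))) f"
| comp_assoc: "morphism_expr \<Sigma> (Comp (Comp f g) h)
    \<Longrightarrow> expr_eq \<Sigma> (Comp (Comp f g) h) (Comp f (Comp g h))"
| tens_id: "\<lbrakk>A \<in> lists (sig_objs \<Sigma>); B \<in> lists (sig_objs \<Sigma>)\<rbrakk>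
    \<Longrightarrow> expr_eq \<Sigma> (Tens (Idt A) (Idt B)) (Idt (A @ B))"
| tens_comp: "\<lbrakk>morphism_expr \<Sigma> (Comp f g); morphism_expr \<Sigma> (Comp h k)\<rbrakk>
    \<Longrightarrow> expr_eq \<Sigma> (Tens (Comp f g) (Comp h k)) (Comp (Tens f h) (Tens g k))"
| tens_unit_left: "morphism_expr \<Sigma> f \<Longrightarrow> expr_eq \<Sigma> (Tens (Idt []) f) f"
| tens_unit_right: "morphism_expr \<Sigma> f \<Longrightarrow> expr_eq \<Sigma> (Tens f (Idt [])) f"
| tens_assoc: "\<lbrakk>morphism_expr \<Sigma> f; morphism_expr \<Sigma> g; morphism_expr \<Sigma> h\<rbrakk>
    \<Longrightarrow> expr_eq \<Sigma> (Tens (Tens f g) h) (Tens f (Tens g h))"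

definition expr_class :: "('o, 'g) signature \<Rightarrow> ('o, 'g) expr \<Rightarrow> ('o, 'g) expr set" where
  "expr_class \<Sigma> f = {g. expr_eq \<Sigma> f g}"

definition class_rep :: "'a set \<Rightarrow> 'a" where
  "class_rep m = (SOME f. f \<in> m)"

definition free_smcat :: "('o, 'g) signature \<Rightarrow> ('o list, ('o, 'g) expr set) smcat" where
  "free_smcat \<Sigma> = \<lparr>
     ob = lists (sig_objs \<Sigma>),
     ar = expr_class \<Sigma> ` {f. morphism_expr \<Sigma> f},
     src = (\<lambda>m. expr_dom \<Sigma> (class_rep m)),
     tgt = (\<lambda>m. expr_cod \<Sigma> (class_rep m)),
     idn = (\<lambda>A. expr_class \<Sigma> (Idt A)),
     cmp = (\<lambda>m n. expr_class \<Sigma> (Comp (class_rep m) (class_rep n))),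
     unt = [],
     tno = (@),
     tna = (\<lambda>m n. expr_class \<Sigma> (Tens (class_rep m) (class_rep n))) \<rparr>"

definition denotation :: "('o, 'g) signature \<Rightarrow> ('o, 'g) expr \<Rightarrow> ('o, 'g) expr set" where
  "denotation \<Sigma> \<phi> = eval_expr (free_smcat \<Sigma>) (\<lambda>x. [x]) (\<lambda>g. expr_class \<Sigma> (Gen g)) \<phi>"

text \<open>The quotient above is a strict monoidal category with the universal property of the free one
  (\<open>free_smcat_strict_monoidal\<close> and \<open>free_smcat_universal\<close> below).\<close>

lemma expr_eq_typed:
  assumes "monoidal_signature \<Sigma>" "expr_eq \<Sigma> f g"
  shows "morphism_expr \<Sigma> f \<and> morphism_expr \<Sigma> g
    \<and> expr_dom \<Sigma> f = expr_dom \<Sigma> g \<and> expr_cod \<Sigma> f = expr_cod \<Sigma> g"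
proof -
  have words: "expr_dom \<Sigma> f \<in> lists (sig_objs \<Sigma>) \<and> expr_cod \<Sigma> f \<in> lists (sig_objs \<Sigma>)"
    if "morphism_expr \<Sigma> f" for f
    using that assms(1) by (induction f) (auto simp: monoidal_signature_def)
  show ?thesis
    using assms(2) by (induction rule: expr_eq.induct) (use words in auto)
qed

lemma expr_words:
  assumes "monoidal_signature \<Sigma>" "morphism_expr \<Sigma> f"
  shows "expr_dom \<Sigma> f \<in> lists (sig_objs \<Sigma>)" "expr_cod \<Sigma> f \<in> lists (sig_objs \<Sigma>)"
  using assms(2,1) by (induction f) (auto simp: monoidal_signature_def)

lemma expr_class_eq_iff:
  assumes "morphism_expr \<Sigma> g"
  shows "expr_class \<Sigma> f = expr_class \<Sigma> g \<longleftrightarrow> expr_eq \<Sigma> f g"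
  using assms unfolding expr_class_def
  by (auto intro: expr_eq.refl expr_eq.sym expr_eq.trans)

lemma expr_class_eqI: "expr_eq \<Sigma> f g \<Longrightarrow> expr_class \<Sigma> f = expr_class \<Sigma> g"
  unfolding expr_class_def by (auto intro: expr_eq.sym expr_eq.trans)

lemma expr_eq_class_rep:
  assumes "morphism_expr \<Sigma> f"
  shows "expr_eq \<Sigma> (class_rep (expr_class \<Sigma> f)) f"
proof -
  have "f \<in> expr_class \<Sigma> f" using assms by (simp add: expr_class_def expr_eq.refl)
  then have "class_rep (expr_class \<Sigma> f) \<in> expr_class \<Sigma> f"
    unfolding class_rep_def by (rule someI)
  then show ?thesis by (simp add: expr_class_def expr_eq.sym)
qed

lemma free_smcat_class:
  assumes "monoidal_signature \<Sigma>"
  shows "morphism_expr \<Sigma> f \<Longrightarrow> src (free_smcat \<Sigma>) (expr_class \<Sigma> f) = expr_dom \<Sigma> f"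
    and "morphism_expr \<Sigma> f \<Longrightarrow> tgt (free_smcat \<Sigma>) (expr_class \<Sigma> f) = expr_cod \<Sigma> f"
    and "morphism_expr \<Sigma> (Comp f g) \<Longrightarrow>
      cmp (free_smcat \<Sigma>) (expr_class \<Sigma> f) (expr_class \<Sigma> g) = expr_class \<Sigma> (Comp f g)"
    and "morphism_expr \<Sigma> (Tens f g) \<Longrightarrow>
      tna (free_smcat \<Sigma>) (expr_class \<Sigma> f) (expr_class \<Sigma> g) = expr_class \<Sigma> (Tens f g)"
proof -
  note rep = expr_eq_class_rep and typed = expr_eq_typed[OF assms]
  show "src (free_smcat \<Sigma>) (expr_class \<Sigma> f) = expr_dom \<Sigma> f" if "morphism_expr \<Sigma> f"
    using typed[OF rep[OF that]] by (simp add: free_smcat_def)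
  show "tgt (free_smcat \<Sigma>) (expr_class \<Sigma> f) = expr_cod \<Sigma> f" if "morphism_expr \<Sigma> f"
    using typed[OF rep[OF that]] by (simp add: free_smcat_def)
  show "cmp (free_smcat \<Sigma>) (expr_class \<Sigma> f) (expr_class \<Sigma> g) = expr_class \<Sigma> (Comp f g)"
    if "morphism_expr \<Sigma> (Comp f g)"
  proof -
    have fg: "expr_eq \<Sigma> (class_rep (expr_class \<Sigma> f)) f" "expr_eq \<Sigma> (class_rep (expr_class \<Sigma> g)) g"
      using that by (simp_all add: rep)
    have "expr_eq \<Sigma> (Comp (class_rep (expr_class \<Sigma> f)) (class_rep (expr_class \<Sigma> g))) (Comp f g)"
      using that typed[OF fg(1)] typed[OF fg(2)] by (intro expr_eq.comp_cong fg) simp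
    then show ?thesis using that by (simp add: free_smcat_def expr_class_eq_iff)
  qed
  show "tna (free_smcat \<Sigma>) (expr_class \<Sigma> f) (expr_class \<Sigma> g) = expr_class \<Sigma> (Tens f g)"
    if "morphism_expr \<Sigma> (Tens f g)"
  proof -
    have fg: "expr_eq \<Sigma> (class_rep (expr_class \<Sigma> f)) f" "expr_eq \<Sigma> (class_rep (expr_class \<Sigma> g)) g"
      using that by (simp_all add: rep)
    then show ?thesis using that
      by (simp add: free_smcat_def expr_class_eq_iff expr_eq.tens_cong)
  qed
qed

lemma free_smcat_simps [simp]:
  "ob (free_smcat \<Sigma>) = lists (sig_objs \<Sigma>)"
  "ar (free_smcat \<Sigma>) = expr_class \<Sigma> ` {f. morphism_expr \<Sigma> f}"
  "idn (free_smcat \<Sigma>) A = expr_class \<Sigma> (Idt A)"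
  "unt (free_smcat \<Sigma>) = []"
  "tno (free_smcat \<Sigma>) = (@)"
  by (simp_all add: free_smcat_def)

theorem free_smcat_strict_monoidal:
  assumes "monoidal_signature \<Sigma>"
  shows "strict_monoidal_category (free_smcat \<Sigma>)"
  using expr_words[OF assms]
  by unfold_locales
    (auto simp: free_smcat_class[OF assms] in_lists_conv_set
      expr_eq.comp_id_left[THEN expr_class_eqI] expr_eq.comp_id_right[THEN expr_class_eqI]
      expr_eq.comp_assoc[THEN expr_class_eqI] expr_eq.tens_id[THEN expr_class_eqI]
      expr_eq.tens_comp[THEN expr_class_eqI] expr_eq.tens_assoc[THEN expr_class_eqI]
      expr_eq.tens_unit_left[THEN expr_class_eqI] expr_eq.tens_unit_right[THEN expr_class_eqI])

lemma eval_word_singleton [simp]: "eval_word (free_smcat \<Sigma>) (\<lambda>x. [x]) A = A"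
  by (induction A) auto

lemma free_smcat_valuation:
  assumes "monoidal_signature \<Sigma>"
  shows "valuation \<Sigma> (free_smcat \<Sigma>) (\<lambda>x. [x]) (\<lambda>g. expr_class \<Sigma> (Gen g))"
  by (auto simp: valuation_def free_smcat_class[OF assms])

lemma denotation_eq_class:
  assumes "monoidal_signature \<Sigma>" "morphism_expr \<Sigma> \<phi>"
  shows "denotation \<Sigma> \<phi> = expr_class \<Sigma> \<phi>"
  using assms(2)
  by (induction \<phi>) (auto simp: denotation_def free_smcat_class[OF assms(1)])

context strict_monoidal_category
begin

lemma eval_word_ob:
  assumes "valuation \<Sigma> C vo vg" "A \<in> lists (sig_objs \<Sigma>)"
  shows "eval_word C vo A \<in> ob C"
  using assms(2) by (induction A) (use assms(1) in \<open>auto simp: valuation_def unt_ob tno_ob\<close>)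

lemma eval_word_append:
  assumes "valuation \<Sigma> C vo vg" "A \<in> lists (sig_objs \<Sigma>)" "B \<in> lists (sig_objs \<Sigma>)"
  shows "eval_word C vo (A @ B) = tno C (eval_word C vo A) (eval_word C vo B)"
  using assms(2)
proof (induction A)
  case Nil
  then show ?case using eval_word_ob[OF assms(1,3)] by (simp add: tno_unt_left)
next
  case (Cons x A)
  then show ?case
    using assms(1) eval_word_ob[OF assms(1,3)] eval_word_ob[OF assms(1) Cons.hyps(2)]
    by (auto simp: valuation_def tno_assoc)
qed

lemma eval_expr_typed:
  assumes "monoidal_signature \<Sigma>" "valuation \<Sigma> C vo vg" "morphism_expr \<Sigma> f"
  shows "eval_expr C vo vg f \<in> ar C \<and> src C (eval_expr C vo vg f) = eval_word C vo (expr_dom \<Sigma> f)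
    \<and> tgt C (eval_expr C vo vg f) = eval_word C vo (expr_cod \<Sigma> f)"
  using assms(3)
proof (induction f)
  case (Gen g)
  then show ?case using assms(2) by (simp add: valuation_def)
next
  case (Idt A)
  then show ?case using eval_word_ob[OF assms(2)] by (simp add: idn_ar src_idn tgt_idn)
next
  case (Comp f g)
  then show ?case by (simp add: cmp_ar src_cmp tgt_cmp)
next
  case (Tens f g)
  then show ?case
    using expr_words[OF assms(1)]
    by (simp add: tna_ar src_tna tgt_tna eval_word_append[OF assms(2)])
qed

lemma eval_expr_eq:
  assumes "monoidal_signature \<Sigma>" "valuation \<Sigma> C vo vg" "expr_eq \<Sigma> f g"
  shows "eval_expr C vo vg f = eval_expr C vo vg g"
  using assms(3)
proof (induction rule: expr_eq.induct)
  case (comp_id_left f)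
  then show ?case using eval_expr_typed[OF assms(1,2)] cmp_idn_left by (metis eval_expr.simps(2,3))
next
  case (comp_id_right f)
  then show ?case using eval_expr_typed[OF assms(1,2)] cmp_idn_right by (metis eval_expr.simps(2,3))
next
  case (comp_assoc f g h)
  then show ?case using eval_expr_typed[OF assms(1,2)] by (simp add: cmp_assoc)
next
  case (tens_id A B)
  then show ?case
    using eval_word_ob[OF assms(2)] by (simp add: tna_idn eval_word_append[OF assms(2)])
next
  case (tens_comp f g h k)
  then show ?case using eval_expr_typed[OF assms(1,2)] by (simp add: tna_cmp)
next
  case (tens_assoc f g h)
  then show ?case using eval_expr_typed[OF assms(1,2)] by (simp add: tna_assoc)
qed (use eval_expr_typed[OF assms(1,2)] in \<open>simp_all add: tna_unt_left tna_unt_right\<close>)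

end

theorem free_smcat_universal:
  fixes C :: "('b, 'm) smcat"
  assumes sig: "monoidal_signature \<Sigma>"
    and C: "strict_monoidal_category C"
    and val: "valuation \<Sigma> C vo vg"
  shows "\<exists>Fo Fa. strict_monoidal_functor (free_smcat \<Sigma>) C Fo Fa \<and>
      (\<forall>x \<in> sig_objs \<Sigma>. Fo [x] = vo x) \<and>
      (\<forall>g \<in> sig_gens \<Sigma>. Fa (expr_class \<Sigma> (Gen g)) = vg g) \<and>
      (\<forall>Fo' Fa'. strict_monoidal_functor (free_smcat \<Sigma>) C Fo' Fa' \<and>
         (\<forall>x \<in> sig_objs \<Sigma>. Fo' [x] = vo x) \<and>
         (\<forall>g \<in> sig_gens \<Sigma>. Fa' (expr_class \<Sigma> (Gen g)) = vg g)
         \<longrightarrow> (\<forall>A \<in> ob (free_smcat \<Sigma>). Fo' A = Fo A) \<and> (\<forall>m \<in> ar (free_smcat \<Sigma>). Fa' m = Fa m))"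
proof -
  interpret C: strict_monoidal_category C by (rule C)
  define Fo where "Fo = eval_word C vo"
  define Fa where "Fa m = eval_expr C vo vg (class_rep m)" for m
  have Fa: "Fa (expr_class \<Sigma> f) = eval_expr C vo vg f" if "morphism_expr \<Sigma> f" for f
    unfolding Fa_def by (rule C.eval_expr_eq[OF sig val expr_eq_class_rep[OF that]])
  note typed = C.eval_expr_typed[OF sig val]
  have "strict_monoidal_functor (free_smcat \<Sigma>) C Fo Fa"
    unfolding strict_monoidal_functor_def
    by (auto simp: free_smcat_class[OF sig] Fa Fo_def typed C.eval_word_ob[OF val]
        C.eval_word_append[OF val])
  moreover have "\<forall>x \<in> sig_objs \<Sigma>. Fo [x] = vo x"
    using val by (simp add: Fo_def valuation_def C.tno_unt_right)
  moreover have "\<forall>g \<in> sig_gens \<Sigma>. Fa (expr_class \<Sigma> (Gen g)) = vg g"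
    by (simp add: Fa)
  moreover have "(\<forall>A \<in> ob (free_smcat \<Sigma>). Fo' A = Fo A) \<and> (\<forall>m \<in> ar (free_smcat \<Sigma>). Fa' m = Fa m)"
    if F: "strict_monoidal_functor (free_smcat \<Sigma>) C Fo' Fa'"
      and Fx: "\<forall>x \<in> sig_objs \<Sigma>. Fo' [x] = vo x"
      and Fg: "\<forall>g \<in> sig_gens \<Sigma>. Fa' (expr_class \<Sigma> (Gen g)) = vg g" for Fo' Fa'
  proof -
    have unit: "Fo' [] = unt C"
      using F by (simp add: strict_monoidal_functor_def)
    have app: "Fo' (A @ B) = tno C (Fo' A) (Fo' B)"
      if "A \<in> lists (sig_objs \<Sigma>)" "B \<in> lists (sig_objs \<Sigma>)" for A B
      using F that by (simp add: strict_monoidal_functor_def)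
    have ob: "Fo' A = Fo A" if "A \<in> lists (sig_objs \<Sigma>)" for A
      using that
    proof (induction A)
      case (Cons x A)
      then show ?case using app[of "[x]" A] Fx by (simp add: Fo_def)
    qed (simp add: unit Fo_def)
    have "Fa' (expr_class \<Sigma> f) = eval_expr C vo vg f" if "morphism_expr \<Sigma> f" for f
      using that
    proof (induction f)
      case (Gen g)
      then show ?case using Fg by simp
    next
      case (Idt A)
      then show ?case using F ob[of A] by (simp add: strict_monoidal_functor_def Fo_def)
    next
      case (Comp f g)
      have "Fa' (cmp (free_smcat \<Sigma>) (expr_class \<Sigma> f) (expr_class \<Sigma> g))
          = cmp C (Fa' (expr_class \<Sigma> f)) (Fa' (expr_class \<Sigma> g))"
        using F Comp.prems by (simp add: strict_monoidal_functor_def free_smcat_class[OF sig])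
      then show ?case using Comp by (simp add: free_smcat_class[OF sig])
    next
      case (Tens f g)
      have "Fa' (tna (free_smcat \<Sigma>) (expr_class \<Sigma> f) (expr_class \<Sigma> g))
          = tna C (Fa' (expr_class \<Sigma> f)) (Fa' (expr_class \<Sigma> g))"
        using F Tens.prems by (simp add: strict_monoidal_functor_def)
      then show ?case using Tens by (simp add: free_smcat_class[OF sig])
    qed
    then show ?thesis using ob by (auto simp: Fa)
  qed
  ultimately show ?thesis by blast
qed


section \<open>Labelled diagrams and exchanges\<close>

text \<open>The functions \<open>H\<close>, \<open>I\<close>, \<open>O\<close>, \<open>L\<close> on \<open>{0..<N}\<close> are tabulated as a list of length \<open>N\<close>, so that
  equality of diagrams only concerns their values on \<open>{0..<N}\<close>.\<close>

datatype 'g entry = Entry (ent_H: nat) (ent_I: nat) (ent_O: nat) (ent_L: 'g)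

record 'g diagram =
  dgS :: nat
  dg_entries :: "'g entry list"

definition dgN :: "'g diagram \<Rightarrow> nat" where "dgN D = length (dg_entries D)"
definition dgH :: "'g diagram \<Rightarrow> nat \<Rightarrow> nat" where "dgH D n = ent_H (dg_entries D ! n)"
definition dgI :: "'g diagram \<Rightarrow> nat \<Rightarrow> nat" where "dgI D n = ent_I (dg_entries D ! n)"
definition dgO :: "'g diagram \<Rightarrow> nat \<Rightarrow> nat" where "dgO D n = ent_O (dg_entries D ! n)"
definition dgL :: "'g diagram \<Rightarrow> nat \<Rightarrow> 'g" where "dgL D n = ent_L (dg_entries D ! n)"

definition dg_delta :: "'g diagram \<Rightarrow> nat \<Rightarrow> int" where
  "dg_delta D n = int (dgO D n) - int (dgI D n)"

text \<open>\<open>conv \<Sigma> \<phi> off es\<close> returns the list \<open>es\<close> with the entries of \<open>\<phi>\<close> appended, together with the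
  numbers of inputs and outputs of \<open>\<phi>\<close>.\<close>

primrec conv :: "('o, 'g) signature \<Rightarrow> ('o, 'g) expr \<Rightarrow> nat \<Rightarrow> 'g entry list
    \<Rightarrow> 'g entry list \<times> nat \<times> nat" where
  "conv \<Sigma> (Gen g) off es =
     (let a = length (gen_dom \<Sigma> g); b = length (gen_cod \<Sigma> g)
      in (es @ [Entry off a b g], a, b))"
| "conv \<Sigma> (Idt A) off es = (es, length A, length A)"
| "conv \<Sigma> (Comp f g) off es =
     (let (es1, a, b) = conv \<Sigma> g off es;
          (es2, b', c) = conv \<Sigma> f off es1
      in (es2, a, c))"
| "conv \<Sigma> (Tens f g) off es =
     (let (es1, a, b) = conv \<Sigma> f off es;
          (es2, c, d) = conv \<Sigma> g (off + b) es1
      in (es2, a + c, b + d))"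

definition diagram_of :: "('o, 'g) signature \<Rightarrow> ('o, 'g) expr \<Rightarrow> 'g diagram" where
  "diagram_of \<Sigma> \<phi> = \<lparr> dgS = length (expr_dom \<Sigma> \<phi>), dg_entries = fst (conv \<Sigma> \<phi> 0 []) \<rparr>"

text \<open>In both exchanges the side condition makes the argument of \<open>nat\<close> nonnegative.\<close>

definition right_exchange :: "nat \<Rightarrow> 'g diagram \<Rightarrow> 'g diagram \<Rightarrow> bool" where
  "right_exchange n D D' \<longleftrightarrow>
     n + 1 < dgN D \<and> dgH D (n + 1) \<ge> dgH D n + dgO D n \<and>
     D' = D\<lparr> dg_entries := (dg_entries D)
       [n := Entry (nat (int (dgH D (n + 1)) - dg_delta D n))
               (dgI D (n + 1)) (dgO D (n + 1)) (dgL D (n + 1)),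
        n + 1 := Entry (dgH D n) (dgI D n) (dgO D n) (dgL D n)] \<rparr>"

definition left_exchange :: "nat \<Rightarrow> 'g diagram \<Rightarrow> 'g diagram \<Rightarrow> bool" where
  "left_exchange n D D' \<longleftrightarrow>
     n + 1 < dgN D \<and> dgH D n \<ge> dgH D (n + 1) + dgI D (n + 1) \<and>
     D' = D\<lparr> dg_entries := (dg_entries D)
       [n := Entry (dgH D (n + 1)) (dgI D (n + 1)) (dgO D (n + 1)) (dgL D (n + 1)),
        n + 1 := Entry (nat (int (dgH D n) + dg_delta D (n + 1)))
               (dgI D n) (dgO D n) (dgL D n)] \<rparr>"

definition exchange :: "'g diagram \<Rightarrow> 'g diagram \<Rightarrow> bool" where
  "exchange D D' \<longleftrightarrow> (\<exists>n. right_exchange n D D' \<or> left_exchange n D D')"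

end

theory Submission
  imports Defs
begin

text \<open>
  If two expressions are equal in the free category, it suffices to look at the generating
  equations; the only one changing the list of entries is the interchange law, and there the
  entries of one block are moved past those of the other by right exchanges.

  Conversely, a list of entries that fits on a word \<open>w\<close> can be read back as a composite of
  whiskered generators \<open>1\<^sub>u \<otimes> g \<otimes> 1\<^sub>v\<close>. An exchange does not change the morphism read
  back, by the interchange law, and reading back the entries of \<open>\<phi>\<close> yields \<open>\<phi>\<close> itself.
\<close>

section \<open>Exchanges on lists of entries\<close>

text \<open>Accumulator-free form of \<open>conv\<close>: the appended list depends only on the
  expression and the offset, and the returned counts are word lengths. This makes structural
  induction direct.\<close>

primrec entries :: "('o, 'g) signature \<Rightarrow> ('o, 'g) expr \<Rightarrow> nat \<Rightarrow> 'g entry list" where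
  "entries \<Sigma> (Gen g) k = [Entry k (length (gen_dom \<Sigma> g)) (length (gen_cod \<Sigma> g)) g]"
| "entries \<Sigma> (Idt A) k = []"
| "entries \<Sigma> (Comp f g) k = entries \<Sigma> g k @ entries \<Sigma> f k"
| "entries \<Sigma> (Tens f g) k = entries \<Sigma> f k @ entries \<Sigma> g (k + length (expr_cod \<Sigma> f))"

text \<open>No typing is assumed: for a composite, \<open>conv\<close> takes the inputs from the
  right factor and the outputs from the left one, exactly as \<open>expr_dom\<close> and
  \<open>expr_cod\<close> do.\<close>

lemma conv_entries:
  "conv \<Sigma> f k es = (es @ entries \<Sigma> f k, length (expr_dom \<Sigma> f), length (expr_cod \<Sigma> f))"
  by (induction f arbitrary: k es) (simp_all add: Let_def)

lemma diagram_of_entries: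
  "diagram_of \<Sigma> f = \<lparr>dgS = length (expr_dom \<Sigma> f), dg_entries = entries \<Sigma> f 0\<rparr>"
  by (simp add: diagram_of_def conv_entries)

text \<open>A right exchange on bare lists. The premise implies \<open>b \<le> k\<close>, so the
  natural subtraction in \<open>k - b + a\<close> is exact and the new height is \<open>k\<close>
  minus the difference of outputs and inputs.\<close>

inductive swap :: "'g entry list \<Rightarrow> 'g entry list \<Rightarrow> bool" where
  swap: "h + b \<le> k \<Longrightarrow> swap (ps @ Entry h a b x # Entry k c d y # qs)
    (ps @ Entry (k - b + a) c d y # Entry h a b x # qs)"

lemma split_at_two:
  assumes "n + 1 < length es"
  shows "es = take n es @ es ! n # es ! (n + 1) # drop (n + 2) es"
  using assms by (simp add: Cons_nth_drop_Suc id_take_nth_drop)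

text \<open>Left exchanges are the inverses of right ones: after a swap the first entry sits at
  \<open>k - b + a \<ge> h + a\<close>, which is the side condition for exchanging back to the
  left.\<close>

lemma exchange_iff:
  "exchange D D' \<longleftrightarrow>
    dgS D = dgS D' \<and> (swap (dg_entries D) (dg_entries D') \<or> swap (dg_entries D') (dg_entries D))"
proof
  assume "exchange D D'"
  then obtain n where n: "right_exchange n D D' \<or> left_exchange n D D'"
    by (auto simp: exchange_def)
  define ps qs where "ps = take n (dg_entries D)" and "qs = drop (n + 2) (dg_entries D)"
  have len: "n + 1 < length (dg_entries D)"
    using n by (auto simp: right_exchange_def left_exchange_def dgN_def)
  obtain h a b x k c d y where nth: "dg_entries D ! n = Entry h a b x"
    "dg_entries D ! (n + 1) = Entry k c d y"
    by (metis entry.exhaust)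
  have es: "dg_entries D = ps @ Entry h a b x # Entry k c d y # qs"
    using split_at_two[OF len] unfolding nth ps_def qs_def .
  have upd: "(dg_entries D)[n := e, n + 1 := f] = ps @ e # f # qs" for e f
  proof -
    have "length ps = n" using len by (simp add: ps_def)
    then show ?thesis unfolding es by (auto simp: list_update_append)
  qed
  note defs = dgN_def dgH_def dgI_def dgO_def dgL_def dg_delta_def nth nth[simplified]
  from n show "dgS D = dgS D' \<and>
    (swap (dg_entries D) (dg_entries D') \<or> swap (dg_entries D') (dg_entries D))"
  proof
    assume "right_exchange n D D'"
    then have le: "h + b \<le> k" and D': "D' = D\<lparr>dg_entries := (dg_entries D)
        [n := Entry (nat (int k - (int b - int a))) c d y, n + 1 := Entry h a b x]\<rparr>"
      by (auto simp: right_exchange_def defs)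
    have "nat (int k - (int b - int a)) = k - b + a" using le by linarith
    then have "dgS D' = dgS D"
      "dg_entries D' = ps @ Entry (k - b + a) c d y # Entry h a b x # qs"
      unfolding D' upd by simp_all
    then show ?thesis using swap.swap[OF le] es by metis
  next
    assume "left_exchange n D D'"
    then have le: "k + c \<le> h" and D': "D' = D\<lparr>dg_entries := (dg_entries D)
        [n := Entry k c d y, n + 1 := Entry (nat (int h + (int d - int c))) a b x]\<rparr>"
      by (auto simp: left_exchange_def defs)
    have eq: "nat (int h + (int d - int c)) = h - c + d" using le by linarith
    then have D'': "dgS D' = dgS D"
      "dg_entries D' = ps @ Entry k c d y # Entry (h - c + d) a b x # qs"
      unfolding D' upd by simp_all
    \<comment> \<open>These are the side condition and the resulting height of the swap that starts
      from the new list and restores the old one.\<close>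
    have "k + d \<le> h - c + d" "h - c + d - d + c = h" using le by linarith+
    then show ?thesis using swap.swap[of k d "h - c + d" ps c y a b x qs] es D'' by metis
  qed
next
  assume asm: "dgS D = dgS D' \<and>
    (swap (dg_entries D) (dg_entries D') \<or> swap (dg_entries D') (dg_entries D))"
  then have S: "dgS D = dgS D'" ..
  note defs = dgN_def dgH_def dgI_def dgO_def dgL_def dg_delta_def nth_append list_update_append
  from asm have "swap (dg_entries D) (dg_entries D') \<or> swap (dg_entries D') (dg_entries D)" ..
  then show "exchange D D'"
  proof
    assume "swap (dg_entries D) (dg_entries D')"
    then obtain h b k ps a x c d y qs where "h + b \<le> k"
      "dg_entries D = ps @ Entry h a b x # Entry k c d y # qs"
      "dg_entries D' = ps @ Entry (k - b + a) c d y # Entry h a b x # qs"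
      by (cases rule: swap.cases) auto
    moreover from this have "nat (int k - (int b - int a)) = k - b + a" by linarith
    ultimately have "right_exchange (length ps) D D'"
      using S by (simp add: right_exchange_def defs)
    then show ?thesis by (auto simp: exchange_def)
  next
    assume "swap (dg_entries D') (dg_entries D)"
    then obtain h b k ps a x c d y qs where "h + b \<le> k"
      "dg_entries D' = ps @ Entry h a b x # Entry k c d y # qs"
      "dg_entries D = ps @ Entry (k - b + a) c d y # Entry h a b x # qs"
      by (cases rule: swap.cases) auto
    moreover from this have "nat (int (k - b + a) + (int b - int a)) = k" by linarith
    ultimately have "left_exchange (length ps) D D'"
      using S by (simp add: left_exchange_def defs)
    then show ?thesis by (auto simp: exchange_def)
  qed
qed

text \<open>By \<open>exchange_iff\<close> a single exchange is a swap read in either direction and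
  keeps \<open>dgS\<close>, so finite sequences of exchanges already form the equivalence closure of
  \<open>swap\<close>.\<close>

lemma exchange_rtranclp_iff:
  "exchange\<^sup>*\<^sup>* \<lparr>dgS = m, dg_entries = es\<rparr> \<lparr>dgS = m, dg_entries = fs\<rparr> \<longleftrightarrow> equivclp swap es fs"
proof
  have "equivclp swap (dg_entries D) (dg_entries D')" if "exchange\<^sup>*\<^sup>* D D'" for D D' :: "'a diagram"
    using that
    by induction (auto simp: exchange_iff intro: equivclp_into_equivclp)
  then show "exchange\<^sup>*\<^sup>* \<lparr>dgS = m, dg_entries = es\<rparr> \<lparr>dgS = m, dg_entries = fs\<rparr> \<Longrightarrow>
    equivclp swap es fs" by fastforce
next
  assume "equivclp swap es fs"
  then show "exchange\<^sup>*\<^sup>* \<lparr>dgS = m, dg_entries = es\<rparr> \<lparr>dgS = m, dg_entries = fs\<rparr>"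
    by (induction rule: equivclp_induct)
      (auto simp: exchange_iff intro: rtranclp.rtrancl_into_rtrancl)
qed


section \<open>Equal expressions have exchange-equivalent entries\<close>

lemma swap_context: "swap es fs \<Longrightarrow> swap (ps @ es @ qs) (ps @ fs @ qs)"
proof (induction rule: swap.induct)
  case (swap h b k ps' a x c d y qs')
  then show ?case using swap.swap[of h b k "ps @ ps'" a x c d y "qs' @ qs"] by simp
qed

lemma equivclp_swap_context:
  "equivclp swap es fs \<Longrightarrow> equivclp swap (ps @ es @ qs) (ps @ fs @ qs)"
proof (induction rule: equivclp_induct)
  case (step fs gs)
  then show ?case using swap_context[of fs gs ps qs] swap_context[of gs fs ps qs]
    by (meson equivclp_into_equivclp)
qed simp

lemma equivclp_swap_append:
  "\<lbrakk>equivclp swap es es'; equivclp swap fs fs'\<rbrakk> \<Longrightarrow> equivclp swap (es @ fs) (es' @ fs')"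
  using equivclp_swap_context[of es es' "[]" fs] equivclp_swap_context[of fs fs' es' "[]"]
  by (auto intro: equivclp_trans)

section \<open>Moving a block of entries past entries lying to its right\<close>

fun shift :: "nat \<Rightarrow> 'g entry \<Rightarrow> 'g entry" where
  "shift m (Entry h a b x) = Entry (h + m) a b x"

lemma shift_shift [simp]: "shift m (shift n e) = shift (n + m) e"
  by (cases e) simp

lemma shift_comp_shift [simp]: "shift m \<circ> shift n = shift (n + m)"
  by (rule ext) simp

lemma ent_H_shift [simp]: "ent_H (shift m e) = ent_H e + m"
  by (cases e) simp

lemma entries_shift: "entries \<Sigma> f (k + m) = map (shift m) (entries \<Sigma> f k)"
proof (induction f arbitrary: k)
  case (Tens f g)
  show ?case using Tens.IH(1)[of k] Tens.IH(2)[of "k + length (expr_cod \<Sigma> f)"]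
    by (simp add: ac_simps)
qed simp_all

lemma entries_ge: "e \<in> set (entries \<Sigma> f k) \<Longrightarrow> k \<le> ent_H e"
  by (induction f arbitrary: k) fastforce+

text \<open>The heights in \<open>es\<close> are counted as if the single entry had no wires. After
  it has acted its \<open>b\<close> outputs lie to the left of \<open>es\<close>, before that its
  \<open>a\<close> inputs do, whence the two shifts. One swap per element of \<open>es\<close>
  carries the entry to the end.\<close>

lemma swap_single:
  assumes "\<forall>e \<in> set es. k \<le> ent_H e"
  shows "equivclp swap (Entry k a b x # map (shift b) es) (map (shift a) es @ [Entry k a b x])"
  using assms
proof (induction es)
  case (Cons e es)
  obtain h c d y where e: "e = Entry h c d y" by (cases e)
  have "swap (Entry k a b x # map (shift b) (e # es))
      (shift a e # Entry k a b x # map (shift b) es)"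
    using swap.swap[of k b "h + b" "[]" a x c d y "map (shift b) es"] Cons.prems by (simp add: e)
  moreover have "equivclp swap (shift a e # Entry k a b x # map (shift b) es)
      (map (shift a) (e # es) @ [Entry k a b x])"
    using equivclp_swap_context[of _ _ "[shift a e]" "[]"] Cons by simp
  ultimately show ?case by (meson equivclp_trans r_into_equivclp)
qed simp

text \<open>Induction on \<open>f\<close> extends \<open>swap_single\<close> from one generator to a
  whole expression; typing makes the intermediate shifts of a composite agree.\<close>

lemma swap_block:
  assumes "morphism_expr \<Sigma> f" "\<forall>e \<in> set es. k \<le> ent_H e"
  shows "equivclp swap (entries \<Sigma> f k @ map (shift (length (expr_cod \<Sigma> f))) es)
    (map (shift (length (expr_dom \<Sigma> f))) es @ entries \<Sigma> f k)"
  using assms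
proof (induction f arbitrary: k es)
  case (Gen g)
  then show ?case by (simp add: swap_single)
next
  case (Comp f g)
  \<comment> \<open>The entries of \<open>f\<close> are adjacent to \<open>es\<close>, so they are
    passed first. The remaining shift by the domain of \<open>f\<close> is the shift by the codomain
    of \<open>g\<close> required by the other induction hypothesis.\<close>
  have "equivclp swap (entries \<Sigma> g k @ entries \<Sigma> f k @ map (shift (length (expr_cod \<Sigma> f))) es)
      (entries \<Sigma> g k @ map (shift (length (expr_dom \<Sigma> f))) es @ entries \<Sigma> f k)"
    using Comp by (intro equivclp_swap_append[OF equivclp_refl]) simp_all
  also have "equivclp swap \<dots>
      ((map (shift (length (expr_dom \<Sigma> g))) es @ entries \<Sigma> g k) @ entries \<Sigma> f k)"
    using equivclp_swap_append[OF Comp.IH(2)[of es k] equivclp_refl[of swap "entries \<Sigma> f k"]] Comp.prems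
    by simp
  finally show ?case by simp
next
  case (Tens f g)
  let ?f = "length (expr_dom \<Sigma> f)" and ?f' = "length (expr_cod \<Sigma> f)"
    and ?g = "length (expr_dom \<Sigma> g)" and ?g' = "length (expr_cod \<Sigma> g)"
  \<comment> \<open>Here \<open>es\<close> is first shifted by \<open>?f'\<close>, which puts it to
    the right of the offset of \<open>g\<close>. In the next step the total shift is read as
    \<open>?g\<close> followed by \<open>?f'\<close>, the form needed to pass
    \<open>f\<close>.\<close>
  have "equivclp swap (entries \<Sigma> g (k + ?f') @ map (shift (?f' + ?g')) es)
      (map (shift (?f' + ?g)) es @ entries \<Sigma> g (k + ?f'))"
    using Tens.IH(2)[of "map (shift ?f') es" "k + ?f'"] Tens.prems by simp
  then have "equivclp swap (entries \<Sigma> f k @ entries \<Sigma> g (k + ?f') @ map (shift (?f' + ?g')) es)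
      ((entries \<Sigma> f k @ map (shift (?g + ?f')) es) @ entries \<Sigma> g (k + ?f'))"
    using equivclp_swap_append[OF equivclp_refl] by (simp add: add.commute)
  also have "equivclp swap \<dots> ((map (shift (?g + ?f)) es @ entries \<Sigma> f k) @ entries \<Sigma> g (k + ?f'))"
    using Tens.IH(1)[of "map (shift ?g) es" k] Tens.prems
    by (intro equivclp_swap_append[OF _ equivclp_refl]) (simp_all add: trans_le_add1)
  finally show ?case by (simp add: add.commute)
qed simp

text \<open>Apart from the interchange law, the axioms equate expressions with the same list. The
  offset \<open>k\<close> is arbitrary because the right factor of a tensor product starts at a
  shifted offset; congruence of tensors needs equal codomains to keep that offset.\<close>

lemma expr_eq_entries:
  assumes "monoidal_signature \<Sigma>" "expr_eq \<Sigma> f g"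
  shows "equivclp swap (entries \<Sigma> f k) (entries \<Sigma> g k)"
  using assms(2)
proof (induction arbitrary: k rule: expr_eq.induct)
  case (sym f g)
  then show ?case by (meson equivclp_sym)
next
  case (trans f g h)
  then show ?case by (meson equivclp_trans)
next
  case (comp_cong f f' g g')
  then show ?case by (simp add: equivclp_swap_append)
next
  case (tens_cong f f' g g')
  then show ?case using expr_eq_typed[OF assms(1)] by (simp add: equivclp_swap_append)
next
  case (tens_comp f g h l)
  \<comment> \<open>The two sides of the interchange law differ only in the order of the blocks of
    \<open>f\<close> and \<open>l\<close>. The block of \<open>l\<close> starts after the codomain
    of \<open>f\<close> or after its domain, which is the codomain of \<open>g\<close>.\<close>
  have "equivclp swap
      (entries \<Sigma> f k @ entries \<Sigma> l (k + length (expr_cod \<Sigma> f)))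
      (entries \<Sigma> l (k + length (expr_dom \<Sigma> f)) @ entries \<Sigma> f k)"
    using swap_block[of \<Sigma> f "entries \<Sigma> l k" k] tens_comp entries_ge
    by (fastforce simp: entries_shift)
  from equivclp_swap_context[OF this] tens_comp show ?case by simp
qed (simp_all add: ac_simps)


section \<open>Reading back a morphism from a list of entries\<close>

lemmas [trans] = expr_eq.trans

abbreviation whisker :: "'o list \<Rightarrow> ('o, 'g) expr \<Rightarrow> 'o list \<Rightarrow> ('o, 'g) expr" where
  "whisker u f v \<equiv> Tens (Idt u) (Tens f (Idt v))"

text \<open>Typing condition under which \<open>readback\<close> yields a morphism expression. It is
  needed because exchanges act on numbers and labels, so the intermediate lists of a chain are not
  given as entries of an expression.\<close>

fun fits :: "('o, 'g) signature \<Rightarrow> 'o list \<Rightarrow> 'g entry list \<Rightarrow> bool" where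
  "fits \<Sigma> w [] \<longleftrightarrow> True"
| "fits \<Sigma> w (Entry h a b g # es) \<longleftrightarrow>
    g \<in> sig_gens \<Sigma> \<and> a = length (gen_dom \<Sigma> g) \<and> b = length (gen_cod \<Sigma> g) \<and>
    (\<exists>u v. w = u @ gen_dom \<Sigma> g @ v \<and> length u = h \<and> fits \<Sigma> (u @ gen_cod \<Sigma> g @ v) es)"

text \<open>Cutting the word with \<open>take\<close> and \<open>drop\<close> keeps the function
  total; on lists that fit, the pieces are the witnesses \<open>u\<close> and \<open>v\<close> of
  \<open>fits\<close>.\<close>

fun readback :: "('o, 'g) signature \<Rightarrow> 'o list \<Rightarrow> 'g entry list \<Rightarrow> ('o, 'g) expr" where
  "readback \<Sigma> w [] = Idt w"
| "readback \<Sigma> w (Entry h a b g # es) =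
    Comp (readback \<Sigma> (take h w @ gen_cod \<Sigma> g @ drop (h + a) w) es)
      (whisker (take h w) (Gen g) (drop (h + a) w))"

context
  fixes \<Sigma> :: "('o, 'g) signature"
  assumes sig: "monoidal_signature \<Sigma>"
begin

abbreviation (input) equal_expr (infix \<open>\<approx>\<close> 50) where "f \<approx> g \<equiv> expr_eq \<Sigma> f g"
abbreviation (input) mor where "mor \<equiv> morphism_expr \<Sigma>"
abbreviation (input) dom' where "dom' \<equiv> expr_dom \<Sigma>"
abbreviation (input) cod' where "cod' \<equiv> expr_cod \<Sigma>"

lemma words:
  "mor f \<Longrightarrow> x \<in> set (dom' f) \<Longrightarrow> x \<in> sig_objs \<Sigma>"
  "mor f \<Longrightarrow> x \<in> set (cod' f) \<Longrightarrow> x \<in> sig_objs \<Sigma>"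
  using expr_words[OF sig, of f] by auto

lemma gen_cod_words:
  "g \<in> sig_gens \<Sigma> \<Longrightarrow> x \<in> set (gen_cod \<Sigma> g) \<Longrightarrow> x \<in> sig_objs \<Sigma>"
  using words(2)[of "Gen g"] by auto

text \<open>Tracking the domain suffices for the induction: the first layer must end at the word on
  which the rest is read back.\<close>

lemma readback_typed:
  "fits \<Sigma> w es \<Longrightarrow> w \<in> lists (sig_objs \<Sigma>) \<Longrightarrow>
    mor (readback \<Sigma> w es) \<and> dom' (readback \<Sigma> w es) = w"
proof (induction es arbitrary: w)
  case (Cons e es)
  obtain h a b g where e: "e = Entry h a b g" by (cases e)
  obtain u v where *: "g \<in> sig_gens \<Sigma>" "w = u @ gen_dom \<Sigma> g @ v" "length u = h"
    "a = length (gen_dom \<Sigma> g)" "fits \<Sigma> (u @ gen_cod \<Sigma> g @ v) es"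
    using Cons.prems(1) by (auto simp: e)
  have "u @ gen_cod \<Sigma> g @ v \<in> lists (sig_objs \<Sigma>)"
    using Cons.prems(2) * gen_cod_words by auto
  from Cons.IH[OF *(5) this] show ?case using * Cons.prems(2) by (auto simp: e)
qed simp

section \<open>Calculus of whiskered morphisms\<close>

lemma comp_cong2:
  "\<lbrakk>f \<approx> f'; g \<approx> g'; mor (Comp f g)\<rbrakk> \<Longrightarrow> Comp f g \<approx> Comp f' g'"
  by (rule expr_eq.comp_cong) auto

lemma comp_id:
  assumes "mor f"
  shows "A = cod' f \<Longrightarrow> Comp (Idt A) f \<approx> f" "A = dom' f \<Longrightarrow> Comp f (Idt A) \<approx> f"
  using assms by (auto intro: expr_eq.intros)

lemma tens_comp_sym:
  "mor (Comp f g) \<Longrightarrow> mor (Comp h k) \<Longrightarrow>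
    Comp (Tens f h) (Tens g k) \<approx> Tens (Comp f g) (Comp h k)"
  by (rule expr_eq.sym, rule expr_eq.tens_comp)

text \<open>Interchange merges the two layers and the identities are absorbed. Together with
  \<open>tens_right_first\<close> this says that two parallel morphisms may be applied in either
  order.\<close>

lemma tens_left_first:
  assumes "mor f" "mor g" "A = cod' f" "B = dom' g"
  shows "Comp (Tens (Idt A) g) (Tens f (Idt B)) \<approx> Tens f g"
proof -
  have "Comp (Tens (Idt A) g) (Tens f (Idt B)) \<approx> Tens (Comp (Idt A) f) (Comp g (Idt B))"
    using assms words by (intro tens_comp_sym) auto
  also have "\<dots> \<approx> Tens f g"
    using assms by (intro expr_eq.tens_cong comp_id) auto
  finally show ?thesis .
qed

lemma tens_right_first:
  assumes "mor f" "mor g" "A = dom' f" "B = cod' g"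
  shows "Comp (Tens f (Idt B)) (Tens (Idt A) g) \<approx> Tens f g"
proof -
  have "Comp (Tens f (Idt B)) (Tens (Idt A) g) \<approx> Tens (Comp f (Idt A)) (Comp (Idt B) g)"
    using assms words by (intro tens_comp_sym) auto
  also have "\<dots> \<approx> Tens f g"
    using assms by (intro expr_eq.tens_cong comp_id) auto
  finally show ?thesis .
qed

lemma comp_whisker_left:
  assumes "u \<in> lists (sig_objs \<Sigma>)" "mor (Comp f g)"
  shows "Comp (Tens (Idt u) f) (Tens (Idt u) g) \<approx> Tens (Idt u) (Comp f g)"
proof -
  have "Comp (Tens (Idt u) f) (Tens (Idt u) g) \<approx> Tens (Comp (Idt u) (Idt u)) (Comp f g)"
    using assms by (intro tens_comp_sym) auto
  also have "\<dots> \<approx> Tens (Idt u) (Comp f g)"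
    using assms by (intro expr_eq.tens_cong comp_id expr_eq.refl) auto
  finally show ?thesis .
qed

lemma comp_whisker_right:
  assumes "v \<in> lists (sig_objs \<Sigma>)" "mor (Comp f g)"
  shows "Comp (Tens f (Idt v)) (Tens g (Idt v)) \<approx> Tens (Comp f g) (Idt v)"
proof -
  have "Comp (Tens f (Idt v)) (Tens g (Idt v)) \<approx> Tens (Comp f g) (Comp (Idt v) (Idt v))"
    using assms by (intro tens_comp_sym) auto
  also have "\<dots> \<approx> Tens (Comp f g) (Idt v)"
    using assms by (intro expr_eq.tens_cong comp_id expr_eq.refl) auto
  finally show ?thesis .
qed

lemma comp_whisker:
  assumes "u \<in> lists (sig_objs \<Sigma>)" "v \<in> lists (sig_objs \<Sigma>)" "mor (Comp f g)"
  shows "Comp (whisker u f v) (whisker u g v) \<approx> whisker u (Comp f g) v"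
proof -
  have "Comp (whisker u f v) (whisker u g v) \<approx> Tens (Idt u) (Comp (Tens f (Idt v)) (Tens g (Idt v)))"
    using assms by (intro comp_whisker_left) auto
  also have "\<dots> \<approx> whisker u (Comp f g) v"
    using assms by (intro expr_eq.tens_cong comp_whisker_right expr_eq.refl) auto
  finally show ?thesis .
qed

text \<open>Used to expose common wires \<open>u\<close> on the left, which
  \<open>comp_whisker_left\<close> then pulls out of a composite.\<close>

lemma whisker_append_left:
  assumes "u \<in> lists (sig_objs \<Sigma>)" "A \<in> lists (sig_objs \<Sigma>)" "mor f"
  shows "Tens (Idt (u @ A)) f \<approx> Tens (Idt u) (Tens (Idt A) f)"
proof -
  have "Tens (Idt (u @ A)) f \<approx> Tens (Tens (Idt u) (Idt A)) f"
    using assms by (intro expr_eq.tens_cong expr_eq.refl expr_eq.sym[OF expr_eq.tens_id]) auto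
  also have "\<dots> \<approx> Tens (Idt u) (Tens (Idt A) f)"
    using assms by (intro expr_eq.tens_assoc) auto
  finally show ?thesis .
qed

lemma whisker_append_right:
  assumes "v \<in> lists (sig_objs \<Sigma>)" "A \<in> lists (sig_objs \<Sigma>)" "mor f"
  shows "Tens f (Idt (A @ v)) \<approx> Tens (Tens f (Idt A)) (Idt v)"
proof -
  have "Tens f (Idt (A @ v)) \<approx> Tens f (Tens (Idt A) (Idt v))"
    using assms by (intro expr_eq.tens_cong expr_eq.refl expr_eq.sym[OF expr_eq.tens_id]) auto
  also have "\<dots> \<approx> Tens (Tens f (Idt A)) (Idt v)"
    using assms by (intro expr_eq.sym[OF expr_eq.tens_assoc]) auto
  finally show ?thesis .
qed

text \<open>The algebraic content of an exchange: both orders of \<open>f\<close> and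
  \<open>g\<close> equal the same whiskered tensor product. The left word of \<open>g\<close>
  contains the codomain of \<open>f\<close> in one order and its domain in the other, which is the
  change of height.\<close>

lemma whisker_tens:
  assumes "u \<in> lists (sig_objs \<Sigma>)" "v \<in> lists (sig_objs \<Sigma>)" "mor f" "mor g"
  shows "Comp (whisker (u @ cod' f) g v) (whisker u f (dom' g @ v)) \<approx> whisker u (Tens f g) v"
    (is ?thesis1)
    and "Comp (whisker u f (cod' g @ v)) (whisker (u @ dom' f) g v) \<approx> whisker u (Tens f g) v"
    (is ?thesis2)
proof -
  have typed: "cod' f \<in> lists (sig_objs \<Sigma>)" "dom' f \<in> lists (sig_objs \<Sigma>)"
    "cod' g \<in> lists (sig_objs \<Sigma>)" "dom' g \<in> lists (sig_objs \<Sigma>)"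
    using assms words by auto
  have assoc: "Tens (Idt u) (Tens f (Tens g (Idt v))) \<approx> whisker u (Tens f g) v"
    using assms by (intro expr_eq.tens_cong expr_eq.refl expr_eq.sym[OF expr_eq.tens_assoc]) auto
  have "Comp (whisker (u @ cod' f) g v) (whisker u f (dom' g @ v)) \<approx>
      Comp (Tens (Idt u) (whisker (cod' f) g v)) (whisker u f (dom' g @ v))"
    using assms typed by (intro comp_cong2 whisker_append_left expr_eq.refl) auto
  also have "\<dots> \<approx> Tens (Idt u) (Comp (whisker (cod' f) g v) (Tens f (Idt (dom' g @ v))))"
    using assms typed by (intro comp_whisker_left) auto
  \<comment> \<open>The right factor taken in \<open>tens_left_first\<close> is \<open>g\<close>
    tensored with the identity on \<open>v\<close>, whose domain is
    \<open>dom' g @ v\<close>.\<close>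
  also have "\<dots> \<approx> Tens (Idt u) (Tens f (Tens g (Idt v)))"
    using assms typed by (intro expr_eq.tens_cong tens_left_first expr_eq.refl) auto
  also note assoc
  finally show ?thesis1 .
  have "Comp (whisker u f (cod' g @ v)) (whisker (u @ dom' f) g v) \<approx>
      Comp (whisker u f (cod' g @ v)) (Tens (Idt u) (whisker (dom' f) g v))"
    using assms typed by (intro comp_cong2 whisker_append_left expr_eq.refl) auto
  also have "\<dots> \<approx> Tens (Idt u) (Comp (Tens f (Idt (cod' g @ v))) (whisker (dom' f) g v))"
    using assms typed by (intro comp_whisker_left) auto
  also have "\<dots> \<approx> Tens (Idt u) (Tens f (Tens g (Idt v)))"
    using assms typed by (intro expr_eq.tens_cong tens_right_first expr_eq.refl) auto
  also note assoc
  finally show ?thesis2 .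
qed

section \<open>Reading back the entries of an expression\<close>

text \<open>Merges the first two layers \<open>q\<close> and \<open>p\<close> of a layered composite
  into \<open>s\<close>, leaving the rest \<open>r\<close> untouched.\<close>

lemma comp_assoc_cong:
  assumes "X \<approx> Comp (Comp r p) q" "Comp p q \<approx> s" "mor (Comp (Comp r p) q)"
  shows "X \<approx> Comp r s"
proof -
  note assms(1)
  also have "Comp (Comp r p) q \<approx> Comp r (Comp p q)"
    using assms by (intro expr_eq.comp_assoc)
  also have "\<dots> \<approx> Comp r s"
    using assms by (intro comp_cong2 expr_eq.refl) auto
  finally show ?thesis .
qed

text \<open>The context is forced by the induction: tensor products require wires \<open>u\<close>
  and \<open>v\<close> on both sides, composites require entries \<open>es\<close> still to
  come.\<close>

lemma readback_entries_append:
  assumes "mor f" "u \<in> lists (sig_objs \<Sigma>)" "v \<in> lists (sig_objs \<Sigma>)"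
    "fits \<Sigma> (u @ cod' f @ v) es"
  shows "fits \<Sigma> (u @ dom' f @ v) (entries \<Sigma> f (length u) @ es) \<and>
    readback \<Sigma> (u @ dom' f @ v) (entries \<Sigma> f (length u) @ es) \<approx>
      Comp (readback \<Sigma> (u @ cod' f @ v) es) (whisker u f v)"
  using assms
proof (induction f arbitrary: u v es)
  case (Gen g)
  have "u @ gen_cod \<Sigma> g @ v \<in> lists (sig_objs \<Sigma>)"
    using Gen gen_cod_words by auto
  from readback_typed[OF _ this, of es] show ?case using Gen
    by (auto intro!: expr_eq.refl)
next
  case (Idt A)
  note t = readback_typed[OF Idt.prems(4)]
  \<comment> \<open>An identity adds no entry, so the identity layer is inserted by hand and split
    into three tensor factors.\<close>
  have "readback \<Sigma> (u @ A @ v) es \<approx> Comp (readback \<Sigma> (u @ A @ v) es) (Idt (u @ A @ v))"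
    using t Idt by (intro expr_eq.sym[OF comp_id(2)]) auto
  also have "\<dots> \<approx> Comp (readback \<Sigma> (u @ A @ v) es) (Tens (Idt u) (Idt (A @ v)))"
    using t Idt by (intro comp_cong2 expr_eq.refl expr_eq.sym[OF expr_eq.tens_id]) auto
  also have "\<dots> \<approx> Comp (readback \<Sigma> (u @ A @ v) es) (whisker u (Idt A) v)"
    using t Idt
    by (intro comp_cong2 expr_eq.tens_cong expr_eq.refl expr_eq.sym[OF expr_eq.tens_id]) auto
  finally show ?case using Idt by simp
next
  case (Comp f g)
  note t = readback_typed[OF Comp.prems(4)]
  let ?r = "readback \<Sigma> (u @ cod' f @ v) es"
  have f: "fits \<Sigma> (u @ dom' f @ v) (entries \<Sigma> f (length u) @ es)"
    "readback \<Sigma> (u @ dom' f @ v) (entries \<Sigma> f (length u) @ es) \<approx> Comp ?r (whisker u f v)"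
    using Comp.IH(1)[of u v es] Comp.prems by auto
  \<comment> \<open>For \<open>g\<close> the entries still to come are those of \<open>f\<close>
    followed by \<open>es\<close>; they fit by the previous fact.\<close>
  have g: "fits \<Sigma> (u @ dom' g @ v) (entries \<Sigma> g (length u) @ entries \<Sigma> f (length u) @ es)"
    "readback \<Sigma> (u @ dom' g @ v) (entries \<Sigma> g (length u) @ entries \<Sigma> f (length u) @ es) \<approx>
      Comp (readback \<Sigma> (u @ dom' f @ v) (entries \<Sigma> f (length u) @ es)) (whisker u g v)"
    using Comp.IH(2)[of u v "entries \<Sigma> f (length u) @ es"] Comp.prems f(1) by auto
  have r: "mor ?r" "dom' ?r = u @ cod' f @ v"
    using t Comp.prems words(2)[of f] by auto
  note g(2)
  also have "Comp (readback \<Sigma> (u @ dom' f @ v) (entries \<Sigma> f (length u) @ es)) (whisker u g v) \<approx>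
      Comp (Comp ?r (whisker u f v)) (whisker u g v)"
    using f(2) Comp.prems r expr_eq_typed[OF sig f(2)] by (intro comp_cong2 expr_eq.refl) auto
  finally have "readback \<Sigma> (u @ dom' g @ v) (entries \<Sigma> g (length u) @ entries \<Sigma> f (length u) @ es)
      \<approx> Comp ?r (whisker u (Comp f g) v)"
    using Comp.prems r by (elim comp_assoc_cong) (auto intro!: comp_whisker)
  then show ?case using g(1) by simp
next
  case (Tens f g)
  note t = readback_typed[OF Tens.prems(4)]
  let ?r = "readback \<Sigma> (u @ cod' f @ cod' g @ v) es"
  let ?g = "entries \<Sigma> g (length u + length (cod' f)) @ es"
  \<comment> \<open>The entries of \<open>g\<close> come after those of \<open>f\<close>, so the
    left context of \<open>g\<close> is \<open>u @ cod' f\<close>, while the right context of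
    \<open>f\<close> is \<open>dom' g @ v\<close>.\<close>
  have g: "fits \<Sigma> (u @ cod' f @ dom' g @ v) ?g"
    "readback \<Sigma> (u @ cod' f @ dom' g @ v) ?g \<approx> Comp ?r (whisker (u @ cod' f) g v)"
    using Tens.IH(2)[of "u @ cod' f" v es] Tens.prems words(2)[of f] by auto
  have f: "fits \<Sigma> (u @ dom' f @ dom' g @ v) (entries \<Sigma> f (length u) @ ?g)"
    "readback \<Sigma> (u @ dom' f @ dom' g @ v) (entries \<Sigma> f (length u) @ ?g) \<approx>
      Comp (readback \<Sigma> (u @ cod' f @ dom' g @ v) ?g) (whisker u f (dom' g @ v))"
    using Tens.IH(1)[of u "dom' g @ v" ?g] Tens.prems g(1) words(1)[of g] by auto
  have r: "mor ?r" "dom' ?r = u @ cod' f @ cod' g @ v"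
    using t Tens.prems words(2)[of f] words(2)[of g] by auto
  note f(2)
  also have "Comp (readback \<Sigma> (u @ cod' f @ dom' g @ v) ?g) (whisker u f (dom' g @ v)) \<approx>
      Comp (Comp ?r (whisker (u @ cod' f) g v)) (whisker u f (dom' g @ v))"
    using g(2) Tens.prems words(1)[of g] expr_eq_typed[OF sig g(2)]
    by (intro comp_cong2 expr_eq.refl) auto
  finally have "readback \<Sigma> (u @ dom' f @ dom' g @ v) (entries \<Sigma> f (length u) @ ?g) \<approx>
      Comp ?r (whisker u (Tens f g) v)"
    using Tens.prems r words(1)[of g] words(2)[of f]
    by (elim comp_assoc_cong) (auto intro!: whisker_tens)
  then show ?case using f(1) by simp
qed

text \<open>The case of empty context; the unit laws then remove the whiskering.\<close>

lemma readback_entries: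
  assumes "mor f"
  shows "fits \<Sigma> (dom' f) (entries \<Sigma> f 0)" "readback \<Sigma> (dom' f) (entries \<Sigma> f 0) \<approx> f"
proof -
  have r: "fits \<Sigma> (dom' f) (entries \<Sigma> f 0)"
    "readback \<Sigma> (dom' f) (entries \<Sigma> f 0) \<approx> Comp (Idt (cod' f)) (whisker [] f [])"
    using readback_entries_append[of f "[]" "[]" "[]"] assms by auto
  show "fits \<Sigma> (dom' f) (entries \<Sigma> f 0)" by (rule r)
  note r(2)
  also have "Comp (Idt (cod' f)) (whisker [] f []) \<approx> whisker [] f []"
    using assms by (intro comp_id) auto
  also have "\<dots> \<approx> Tens f (Idt [])"
    using assms by (intro expr_eq.tens_unit_left) auto
  also have "\<dots> \<approx> f"
    using assms by (intro expr_eq.tens_unit_right) auto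
  finally show "readback \<Sigma> (dom' f) (entries \<Sigma> f 0) \<approx> f" .
qed

section \<open>Invariance of the readback under exchanges\<close>

text \<open>The wires \<open>m\<close> between the two generators are absorbed into
  \<open>x\<close>. The factors \<open>?x\<close> and \<open>y\<close> are then adjacent, and both
  orders equal their whiskered tensor product by \<open>whisker_tens\<close>.\<close>

lemma readback_swap_head:
  assumes "mor (Gen x)" "mor (Gen y)" "u \<in> lists (sig_objs \<Sigma>)" "m \<in> lists (sig_objs \<Sigma>)"
    "v \<in> lists (sig_objs \<Sigma>)"
    "mor r" "dom' r = u @ gen_cod \<Sigma> x @ m @ gen_cod \<Sigma> y @ v"
  shows "Comp (Comp r (whisker (u @ gen_cod \<Sigma> x @ m) (Gen y) v))
      (whisker u (Gen x) (m @ gen_dom \<Sigma> y @ v)) \<approx>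
    Comp (Comp r (whisker u (Gen x) (m @ gen_cod \<Sigma> y @ v)))
      (whisker (u @ gen_dom \<Sigma> x @ m) (Gen y) v)"
proof -
  let ?x = "Tens (Gen x) (Idt m)"
  have x: "gen_dom \<Sigma> x \<in> lists (sig_objs \<Sigma>)" "gen_cod \<Sigma> x \<in> lists (sig_objs \<Sigma>)"
    and y: "gen_dom \<Sigma> y \<in> lists (sig_objs \<Sigma>)" "gen_cod \<Sigma> y \<in> lists (sig_objs \<Sigma>)"
    using assms expr_words[OF sig, of "Gen x"] expr_words[OF sig, of "Gen y"] by auto
  have w: "whisker u (Gen x) (m @ A) \<approx> whisker u ?x A" if "A \<in> lists (sig_objs \<Sigma>)" for A
    using assms that by (intro expr_eq.tens_cong expr_eq.refl whisker_append_right) auto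
  have "Comp (whisker (u @ gen_cod \<Sigma> x @ m) (Gen y) v) (whisker u (Gen x) (m @ gen_dom \<Sigma> y @ v))
      \<approx> Comp (whisker (u @ gen_cod \<Sigma> x @ m) (Gen y) v) (whisker u ?x (gen_dom \<Sigma> y @ v))"
    using assms x y by (intro comp_cong2 expr_eq.refl w) auto
  also have "\<dots> \<approx> whisker u (Tens ?x (Gen y)) v"
    using whisker_tens(1)[of u v ?x "Gen y"] assms by simp
  also have "\<dots> \<approx> Comp (whisker u ?x (gen_cod \<Sigma> y @ v)) (whisker (u @ gen_dom \<Sigma> x @ m) (Gen y) v)"
    using expr_eq.sym[OF whisker_tens(2)[of u v ?x "Gen y"]] assms by simp
  also have "\<dots> \<approx> Comp (whisker u (Gen x) (m @ gen_cod \<Sigma> y @ v))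
      (whisker (u @ gen_dom \<Sigma> x @ m) (Gen y) v)"
    using assms x y by (intro comp_cong2 expr_eq.refl expr_eq.sym[OF w]) auto
  finally have "Comp (Comp r (whisker (u @ gen_cod \<Sigma> x @ m) (Gen y) v))
      (whisker u (Gen x) (m @ gen_dom \<Sigma> y @ v)) \<approx>
    Comp r (Comp (whisker u (Gen x) (m @ gen_cod \<Sigma> y @ v))
      (whisker (u @ gen_dom \<Sigma> x @ m) (Gen y) v))"
    using assms x y by (intro comp_assoc_cong[OF expr_eq.refl]) auto
  also have "\<dots> \<approx> Comp (Comp r (whisker u (Gen x) (m @ gen_cod \<Sigma> y @ v)))
      (whisker (u @ gen_dom \<Sigma> x @ m) (Gen y) v)"
    using assms x y by (intro expr_eq.sym[OF expr_eq.comp_assoc]) auto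
  finally show ?thesis .
qed

lemma append_eq_append_split:
  assumes "p @ q = p' @ q'" "length p \<le> length p'"
  obtains m where "p' = p @ m" "q = m @ q'"
  using assms by (metis append_eq_append_conv_if append_eq_conv_conj append_take_drop_id)

text \<open>The premise places the inputs of \<open>y\<close> to the right of the outputs of
  \<open>x\<close>, so one splitting of \<open>w\<close> serves both generators. Here
  \<open>k\<close> is measured after \<open>x\<close> has acted.\<close>

lemma fits_pair_left:
  assumes "h + b \<le> k"
  shows "fits \<Sigma> w (Entry h a b x # Entry k c d y # qs) \<longleftrightarrow>
    x \<in> sig_gens \<Sigma> \<and> y \<in> sig_gens \<Sigma> \<and> a = length (gen_dom \<Sigma> x) \<and> b = length (gen_cod \<Sigma> x) \<and>
    c = length (gen_dom \<Sigma> y) \<and> d = length (gen_cod \<Sigma> y) \<and>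
    (\<exists>u m v. w = u @ gen_dom \<Sigma> x @ m @ gen_dom \<Sigma> y @ v \<and> length u = h \<and>
      length (u @ gen_cod \<Sigma> x @ m) = k \<and> fits \<Sigma> (u @ gen_cod \<Sigma> x @ m @ gen_cod \<Sigma> y @ v) qs)"
    (is "?l \<longleftrightarrow> ?r")
proof
  assume ?l
  then obtain u v' u' v where *: "x \<in> sig_gens \<Sigma>" "y \<in> sig_gens \<Sigma>"
    "a = length (gen_dom \<Sigma> x)" "b = length (gen_cod \<Sigma> x)"
    "c = length (gen_dom \<Sigma> y)" "d = length (gen_cod \<Sigma> y)"
    "w = u @ gen_dom \<Sigma> x @ v'" "length u = h" "u @ gen_cod \<Sigma> x @ v' = u' @ gen_dom \<Sigma> y @ v"
    "length u' = k" "fits \<Sigma> (u' @ gen_cod \<Sigma> y @ v) qs"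
    by auto
  \<comment> \<open>Since \<open>h + b \<le> k\<close>, the prefix ending with the outputs of
    \<open>x\<close> is no longer than the prefix \<open>u'\<close> before \<open>y\<close>; the
    difference is \<open>m\<close>.\<close>
  obtain m where "u' = (u @ gen_cod \<Sigma> x) @ m" "v' = m @ gen_dom \<Sigma> y @ v"
    by (rule append_eq_append_split[of "u @ gen_cod \<Sigma> x" v' u' "gen_dom \<Sigma> y @ v"])
      (use * assms in auto)
  with * show ?r by auto
next
  assume ?r
  then obtain u m v where *: "x \<in> sig_gens \<Sigma>" "y \<in> sig_gens \<Sigma>"
    "a = length (gen_dom \<Sigma> x)" "b = length (gen_cod \<Sigma> x)"
    "c = length (gen_dom \<Sigma> y)" "d = length (gen_cod \<Sigma> y)"
    "w = u @ gen_dom \<Sigma> x @ m @ gen_dom \<Sigma> y @ v" "length u = h"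
    "length (u @ gen_cod \<Sigma> x @ m) = k" "fits \<Sigma> (u @ gen_cod \<Sigma> x @ m @ gen_cod \<Sigma> y @ v) qs"
    by blast
  have "fits \<Sigma> (u @ gen_cod \<Sigma> x @ m @ gen_dom \<Sigma> y @ v) (Entry k c d y # qs)"
    unfolding fits.simps
    by (intro conjI exI[of _ "u @ gen_cod \<Sigma> x @ m"] exI[of _ v]) (use * in auto)
  then show ?l using * by (subst fits.simps(2)) blast
qed

text \<open>The normal form of \<open>fits_pair_left\<close> for the opposite order. Now
  \<open>k\<close> is measured before \<open>x\<close> acts, so its length condition involves
  \<open>gen_dom \<Sigma> x\<close>.\<close>

lemma fits_pair_right:
  assumes "h + a \<le> k"
  shows "fits \<Sigma> w (Entry k c d y # Entry h a b x # qs) \<longleftrightarrow>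
    x \<in> sig_gens \<Sigma> \<and> y \<in> sig_gens \<Sigma> \<and> a = length (gen_dom \<Sigma> x) \<and> b = length (gen_cod \<Sigma> x) \<and>
    c = length (gen_dom \<Sigma> y) \<and> d = length (gen_cod \<Sigma> y) \<and>
    (\<exists>u m v. w = u @ gen_dom \<Sigma> x @ m @ gen_dom \<Sigma> y @ v \<and> length u = h \<and>
      length (u @ gen_dom \<Sigma> x @ m) = k \<and> fits \<Sigma> (u @ gen_cod \<Sigma> x @ m @ gen_cod \<Sigma> y @ v) qs)"
    (is "?l \<longleftrightarrow> ?r")
proof
  assume ?l
  then obtain u v' u' v where *: "x \<in> sig_gens \<Sigma>" "y \<in> sig_gens \<Sigma>"
    "a = length (gen_dom \<Sigma> x)" "b = length (gen_cod \<Sigma> x)"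
    "c = length (gen_dom \<Sigma> y)" "d = length (gen_cod \<Sigma> y)"
    "w = u' @ gen_dom \<Sigma> y @ v" "length u' = k" "u @ gen_dom \<Sigma> x @ v' = u' @ gen_cod \<Sigma> y @ v"
    "length u = h" "fits \<Sigma> (u @ gen_cod \<Sigma> x @ v') qs"
    by (auto; metis)
  obtain m where "u' = (u @ gen_dom \<Sigma> x) @ m" "v' = m @ gen_cod \<Sigma> y @ v"
    by (rule append_eq_append_split[of "u @ gen_dom \<Sigma> x" v' u' "gen_cod \<Sigma> y @ v"])
      (use * assms in auto)
  with * show ?r by auto
next
  assume ?r
  then obtain u m v where *: "x \<in> sig_gens \<Sigma>" "y \<in> sig_gens \<Sigma>"
    "a = length (gen_dom \<Sigma> x)" "b = length (gen_cod \<Sigma> x)"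
    "c = length (gen_dom \<Sigma> y)" "d = length (gen_cod \<Sigma> y)"
    "w = u @ gen_dom \<Sigma> x @ m @ gen_dom \<Sigma> y @ v" "length u = h"
    "length (u @ gen_dom \<Sigma> x @ m) = k" "fits \<Sigma> (u @ gen_cod \<Sigma> x @ m @ gen_cod \<Sigma> y @ v) qs"
    by blast
  have "fits \<Sigma> ((u @ gen_dom \<Sigma> x @ m) @ gen_cod \<Sigma> y @ v) (Entry h a b x # qs)"
    using * by auto
  moreover have "w = (u @ gen_dom \<Sigma> x @ m) @ gen_dom \<Sigma> y @ v" using * by simp
  ultimately show ?l using * by (subst fits.simps(2)) blast
qed

text \<open>Fitting is shown to be equivalent for both lists because the equivalence closure also
  uses swaps backwards. The word varies in the induction on the common prefix, since each entry
  rewrites it.\<close>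

lemma swap_readback:
  assumes "swap es fs" "w \<in> lists (sig_objs \<Sigma>)"
  shows "(fits \<Sigma> w es \<longleftrightarrow> fits \<Sigma> w fs) \<and> (fits \<Sigma> w es \<longrightarrow> readback \<Sigma> w es \<approx> readback \<Sigma> w fs)"
  using assms
proof (induction arbitrary: w rule: swap.induct)
  case (swap h b k ps a x c d y qs)
  let ?l = "Entry h a b x # Entry k c d y # qs"
    and ?r = "Entry (k - b + a) c d y # Entry h a b x # qs"
  show ?case using swap.prems
  proof (induction ps arbitrary: w)
    case Nil
    have le: "h + a \<le> k - b + a" using swap.hyps by linarith
    note pairs = fits_pair_left[OF swap.hyps, of w a x c d y qs]
      fits_pair_right[OF le, of w c d y b x qs]
    \<comment> \<open>The normal forms differ only in the height of \<open>y\<close>: the prefix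
      through \<open>gen_cod \<Sigma> x\<close> and \<open>m\<close> has length \<open>k\<close> iff
      the one through \<open>gen_dom \<Sigma> x\<close> and \<open>m\<close> has length
      \<open>k - b + a\<close>.\<close>
    have "fits \<Sigma> w ?l \<longleftrightarrow> fits \<Sigma> w ?r"
      unfolding pairs using swap.hyps by (intro conj_cong iff_exI HOL.refl) auto
    moreover have "readback \<Sigma> w ?l \<approx> readback \<Sigma> w ?r" if "fits \<Sigma> w ?l"
    proof -
      from that obtain u m v where *: "x \<in> sig_gens \<Sigma>" "y \<in> sig_gens \<Sigma>"
        "a = length (gen_dom \<Sigma> x)" "b = length (gen_cod \<Sigma> x)"
        "c = length (gen_dom \<Sigma> y)" "d = length (gen_cod \<Sigma> y)"
        "w = u @ gen_dom \<Sigma> x @ m @ gen_dom \<Sigma> y @ v" "h = length u"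
        "k = length u + length (gen_cod \<Sigma> x) + length m"
        "fits \<Sigma> (u @ gen_cod \<Sigma> x @ m @ gen_cod \<Sigma> y @ v) qs"
        unfolding pairs by auto
      have t: "mor (readback \<Sigma> (u @ gen_cod \<Sigma> x @ m @ gen_cod \<Sigma> y @ v) qs)"
        "dom' (readback \<Sigma> (u @ gen_cod \<Sigma> x @ m @ gen_cod \<Sigma> y @ v) qs) =
          u @ gen_cod \<Sigma> x @ m @ gen_cod \<Sigma> y @ v"
        using readback_typed[OF *(10)] * Nil gen_cod_words by auto
      show ?thesis
        using readback_swap_head[of x y u m v, OF _ _ _ _ _ t] * Nil by simp
    qed
    ultimately show ?case by simp
  next
    case (Cons e ps)
    obtain i j l z where e: "e = Entry i j l z" by (cases e)
    have IH: "(fits \<Sigma> w (ps @ ?l) \<longleftrightarrow> fits \<Sigma> w (ps @ ?r)) \<and>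
        (fits \<Sigma> w (ps @ ?l) \<longrightarrow> readback \<Sigma> w (ps @ ?l) \<approx> readback \<Sigma> w (ps @ ?r))"
      if "w \<in> lists (sig_objs \<Sigma>)" for w
      using Cons.IH[OF that] .
    have "fits \<Sigma> (u @ gen_cod \<Sigma> z @ v) (ps @ ?l) \<longleftrightarrow> fits \<Sigma> (u @ gen_cod \<Sigma> z @ v) (ps @ ?r)"
      if "z \<in> sig_gens \<Sigma>" "w = u @ gen_dom \<Sigma> z @ v" for u v
      using IH[of "u @ gen_cod \<Sigma> z @ v"] that gen_cod_words Cons.prems by auto
    then have "fits \<Sigma> w (e # ps @ ?l) \<longleftrightarrow> fits \<Sigma> w (e # ps @ ?r)"
      unfolding e fits.simps by blast
    moreover have "readback \<Sigma> w (e # ps @ ?l) \<approx> readback \<Sigma> w (e # ps @ ?r)"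
      if fits: "fits \<Sigma> w (e # ps @ ?l)"
    proof -
      from fits obtain u v where *: "z \<in> sig_gens \<Sigma>" "j = length (gen_dom \<Sigma> z)"
        "w = u @ gen_dom \<Sigma> z @ v" "i = length u"
        "fits \<Sigma> (u @ gen_cod \<Sigma> z @ v) (ps @ ?l)"
        unfolding e by auto
      have w': "u @ gen_cod \<Sigma> z @ v \<in> lists (sig_objs \<Sigma>)"
        using * Cons.prems gen_cod_words by auto
      have "Comp (readback \<Sigma> (u @ gen_cod \<Sigma> z @ v) (ps @ ?l)) (whisker u (Gen z) v) \<approx>
        Comp (readback \<Sigma> (u @ gen_cod \<Sigma> z @ v) (ps @ ?r)) (whisker u (Gen z) v)"
        using IH[OF w'] readback_typed[OF *(5) w'] * Cons.prems
        by (intro comp_cong2 expr_eq.refl) auto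
      then show ?thesis using * by (simp add: e)
    qed
    ultimately show ?case by simp
  qed
qed

lemma equivclp_swap_readback:
  assumes "equivclp swap es fs" "fits \<Sigma> w es" "w \<in> lists (sig_objs \<Sigma>)"
  shows "fits \<Sigma> w fs \<and> readback \<Sigma> w es \<approx> readback \<Sigma> w fs"
  using assms(1)
proof (induction rule: equivclp_induct)
  case base
  then show ?case using readback_typed assms by (simp add: expr_eq.refl)
next
  case (step fs gs)
  then show ?case
    using swap_readback[OF _ assms(3)] expr_eq.trans expr_eq.sym by meson
qed

text \<open>A list does not determine the word on which it acts, as every identity has the empty
  list. The common domain lets both lists be read back on the same word.\<close>

lemma equivclp_swap_expr_eq:
  assumes "mor f" "mor g" "dom' f = dom' g" "equivclp swap (entries \<Sigma> f 0) (entries \<Sigma> g 0)"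
  shows "f \<approx> g"
proof -
  have "f \<approx> readback \<Sigma> (dom' f) (entries \<Sigma> f 0)"
    using readback_entries assms by (blast intro: expr_eq.sym)
  also have "\<dots> \<approx> readback \<Sigma> (dom' f) (entries \<Sigma> g 0)"
    using equivclp_swap_readback[OF assms(4)] readback_entries(1) assms(1) expr_words(1)[OF sig]
    by blast
  also have "\<dots> \<approx> g"
    using readback_entries(2)[OF assms(2)] assms(3) by simp
  finally show ?thesis .
qed

end

theorem theorem16:
  fixes \<Sigma> :: "('o, 'g) signature"
    and \<phi> \<psi> :: "('o, 'g) expr"
  assumes "monoidal_signature \<Sigma>"
    and "morphism_expr \<Sigma> \<phi>"
    and "morphism_expr \<Sigma> \<psi>"
    and "expr_dom \<Sigma> \<phi> = expr_dom \<Sigma> \<psi>"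
    and "expr_cod \<Sigma> \<phi> = expr_cod \<Sigma> \<psi>"
  shows "denotation \<Sigma> \<phi> = denotation \<Sigma> \<psi>
    \<longleftrightarrow> exchange\<^sup>*\<^sup>* (diagram_of \<Sigma> \<phi>) (diagram_of \<Sigma> \<psi>)"
proof -
  have "denotation \<Sigma> \<phi> = denotation \<Sigma> \<psi> \<longleftrightarrow> expr_eq \<Sigma> \<phi> \<psi>"
    using assms by (simp add: denotation_eq_class expr_class_eq_iff)
  also have "\<dots> \<longleftrightarrow> equivclp swap (entries \<Sigma> \<phi> 0) (entries \<Sigma> \<psi> 0)"
    using expr_eq_entries equivclp_swap_expr_eq assms by blast
  \<comment> \<open>Equal domains give both diagrams the same number of inputs, so only their lists
    have to be compared.\<close>
  also have "\<dots> \<longleftrightarrow> exchange\<^sup>*\<^sup>* (diagram_of \<Sigma> \<phi>) (diagram_of \<Sigma> \<psi>)"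
    using assms by (simp add: diagram_of_entries exchange_rtranclp_iff)
  finally show ?thesis .
qed

end
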